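(* An $\omega$-Stone space $W$ is uniform if and only if $W=X\dotplus Y$ (with $X,Y$ disjoint clopen subsets of $W$), where $X$ is strongly uniform and $Y$ is either empty or a scattered space of type $(\rho,\rho)$ for some ordinal $\rho$ with $\rho_U(X)<\rho\leqslant\nu(X)$ (and where then $\rho=\rho(W)$).
   Context: An $\omega$-Stone space is a locally compact metrisable totally disconnected Hausdorff space. For $S\subseteq W$, $S'$ is the derived set; $W^{(0)}=W$, $W^{(\xi+1)}=(W^{(\xi)})'$, $W^{(\eta)}=\bigcap_{\xi<\eta}W^{(\xi)}$ for limit $\eta$; $W^{[\xi]}=W^{(\xi)}-W^{(\xi+1)}$; $\nu(W)=\min\{\xi\mid W^{(\xi)}=W^{(\xi+1)}\}$; $K(W)=W^{(\nu(W))}$; $\lambda(W)=\min\{\xi\mid W^{(\xi)}-K(W)\text{ closed}\}$; $n(W)=|W^{(\mu)}-K(W)|$ if $\nu(W)=\mu+1$ and this is finite, else $-\infty$; $r_W(x)=\min\{\xi\mid x\notin\overline{W^{(\xi)}-K(W)}\}$ for $x\in K(W)$; $K_\xi(W)=\{w\in K(W)\mid r_W(w)>\xi\}$; $\rho(W)=\min\{\xi\mid\overline{W^{[\xi]}}\text{ compact}\}$; $\rho_U(W)=\min\{\xi\mid K_\xi(W)\text{ compact}\}$. $W$ is scattered if $K(W)=\emptyset$, uniform if $\nu(W)=\lambda(W)$, strongly uniform if uniform and $\rho_U(W)=\rho(W)$. A scattered $W$ has type $(\nu(W),\nu(W))$ if $\rho(W)=\nu(W)$, and type $(\nu(W),\rho(W),n(W))$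 otherwise. *)

theory Defs
  imports "HOL-Analysis.Analysis"
begin

section \<open>Ordinals\<close>

text \<open>
  The type \<open>'a ordinal\<close> is the initial ordinal of cardinality
  \<open>(|nat| + |'a|)\<^sup>+\<close>, i.e. it consists of (representatives of) all ordinals below that
  cardinal.  It has no greatest element and does not inject into \<open>'a\<close>, so for a topological
  space with points in \<open>'a\<close> it contains all ordinals at which the derived sequence can still
  change, and every minimum over ordinals taken below is attained in it
  (see the lemmas named \<open>*_attained\<close>).
\<close>

unbundle cardinal_syntax

abbreviation ordinal_rel :: "'a itself \<Rightarrow> (nat + 'a) set rel" where
  "ordinal_rel _ \<equiv> cardSuc (natLeq +c |UNIV :: 'a set| )"

lemma ordinal_base_Cinfinite: "Cinfinite (natLeq +c |UNIV :: 'a set| )"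
  by (rule Cinfinite_csum1[OF natLeq_Cinfinite])

lemma ordinal_rel_Card_order: "Card_order (ordinal_rel TYPE('a))"
  by (rule cardSuc_Card_order) (use ordinal_base_Cinfinite in blast)

lemma ordinal_rel_infinite: "infinite (Field (ordinal_rel TYPE('a)))"
  using ordinal_base_Cinfinite[where 'a='a] cardSuc_finite unfolding cinfinite_def by blast

lemma ordinal_rel_Well_order: "Well_order (ordinal_rel TYPE('a))"
  using ordinal_rel_Card_order card_order_on_well_order_on by blast

typedef 'a ordinal = "Field (ordinal_rel TYPE('a))"
  using ordinal_rel_infinite[where 'a='a] by (metis all_not_in_conv finite.emptyI)

instantiation ordinal :: (type) linorder
begin

definition less_eq_ordinal :: "'a ordinal \<Rightarrow> 'a ordinal \<Rightarrow> bool" where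
  "\<xi> \<le> \<eta> \<longleftrightarrow> (Rep_ordinal \<xi>, Rep_ordinal \<eta>) \<in> ordinal_rel TYPE('a)"

definition less_ordinal :: "'a ordinal \<Rightarrow> 'a ordinal \<Rightarrow> bool" where
  "\<xi> < \<eta> \<longleftrightarrow> \<xi> \<le> \<eta> \<and> \<not> \<eta> \<le> (\<xi> :: 'a ordinal)"

instance
proof
  have lin: "Linear_order (ordinal_rel TYPE('a))"
    using ordinal_rel_Well_order unfolding well_order_on_def by blast
  fix x y z :: "'a ordinal"
  show "(x < y) = (x \<le> y \<and> \<not> y \<le> x)"
    by (rule less_ordinal_def)
  show "x \<le> x"
    using lin Rep_ordinal[of x]
    unfolding less_eq_ordinal_def order_on_defs refl_on_def by blast
  show "x \<le> z" if "x \<le> y" "y \<le> z"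
    using lin that unfolding less_eq_ordinal_def order_on_defs by (meson transD)
  show "x = y" if "x \<le> y" "y \<le> x"
    using lin that Rep_ordinal_inject unfolding less_eq_ordinal_def order_on_defs
    by (meson antisymD)
  show "x \<le> y \<or> y \<le> x"
    using lin Rep_ordinal[of x] Rep_ordinal[of y] Rep_ordinal_inject[of x y]
    unfolding less_eq_ordinal_def order_on_defs total_on_def refl_on_def by metis
qed

end

instance ordinal :: (type) wellorder
proof
  fix P :: "'a ordinal \<Rightarrow> bool" and a
  assume step: "\<And>x. (\<And>y. y < x \<Longrightarrow> P y) \<Longrightarrow> P x"
  have "wf (ordinal_rel TYPE('a) - Id)"
    using ordinal_rel_Well_order unfolding well_order_on_def by blast
  then have "wf (inv_image (ordinal_rel TYPE('a) - Id) Rep_ordinal)"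
    by (rule wf_inv_image)
  moreover have "{(x, y). x < (y :: 'a ordinal)} \<subseteq> inv_image (ordinal_rel TYPE('a) - Id) Rep_ordinal"
    by (auto simp: less_le less_eq_ordinal_def Rep_ordinal_inject)
  ultimately have "wf {(x, y). x < (y :: 'a ordinal)}"
    by (rule wf_subset)
  then show "P a"
    by (rule wf_induct) (use step in blast)
qed

instance ordinal :: (type) no_top
proof
  fix x :: "'a ordinal"
  obtain b where b: "b \<in> Field (ordinal_rel TYPE('a))" "Rep_ordinal x \<noteq> b"
    "(Rep_ordinal x, b) \<in> ordinal_rel TYPE('a)"
    using infinite_Card_order_limit[OF ordinal_rel_Card_order ordinal_rel_infinite Rep_ordinal]
    by blast
  then have "x < Abs_ordinal b"
    unfolding less_le less_eq_ordinal_def by (metis Abs_ordinal_inverse)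
  then show "\<exists>y. x < y" ..
qed

lemma ordinal_no_inj: "\<not> inj (f :: 'a ordinal \<Rightarrow> 'a)"
proof
  assume f: "inj f"
  let ?b = "natLeq +c |UNIV :: 'a set|" and ?r = "ordinal_rel TYPE('a)"
  have "?r =o |Field ?r|"
    using card_of_Field_ordIso[OF ordinal_rel_Card_order] ordIso_symmetric by blast
  moreover have "|Field ?r| \<le>o |UNIV :: 'a set|"
  proof (rule card_of_ordLeqI[of "f \<circ> Abs_ordinal"])
    show "inj_on (f \<circ> Abs_ordinal) (Field ?r)"
      using f by (intro comp_inj_on) (meson Abs_ordinal_inject inj_onI, meson inj_on_subset subset_UNIV)
  qed simp
  moreover have "|UNIV :: 'a set| \<le>o ?b"
    by (rule ordLeq_csum2) (rule card_of_Card_order)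
  moreover have "?b <o ?r"
    by (rule cardSuc_greater) (use ordinal_base_Cinfinite in blast)
  ultimately show False
    by (meson not_ordLess_ordLeq ordIso_ordLeq_trans ordLeq_transitive)
qed

unbundle no cardinal_syntax

instantiation ordinal :: (type) zero
begin
definition zero_ordinal :: "'a ordinal" where "(0 :: 'a ordinal) = (LEAST \<xi>. True)"
instance ..
end

lemma ordinal_zero_le [simp]: "0 \<le> (\<xi> :: 'a ordinal)"
  unfolding zero_ordinal_def by (rule Least_le) simp

definition osucc :: "'a ordinal \<Rightarrow> 'a ordinal" where
  "osucc \<xi> = (LEAST \<eta>. \<xi> < \<eta>)"

lemma less_osucc [simp]: "\<xi> < osucc \<xi>"
  unfolding osucc_def by (metis LeastI_ex gt_ex)

lemma osucc_le_iff: "osucc \<xi> \<le> \<eta> \<longleftrightarrow> \<xi> < \<eta>"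
  by (metis Least_le less_le_trans less_osucc osucc_def)

lemma less_osucc_iff: "\<eta> < osucc \<xi> \<longleftrightarrow> \<eta> \<le> \<xi>"
  by (meson not_le osucc_le_iff)

lemma osucc_inject [simp]: "osucc \<xi> = osucc \<eta> \<longleftrightarrow> \<xi> = \<eta>"
  by (metis less_osucc_iff order_antisym order_refl)

lemma osucc_neq_zero [simp]: "osucc \<xi> \<noteq> 0"
  by (metis less_osucc leD ordinal_zero_le)


section \<open>Derived sequence and invariants\<close>

definition totally_disconnected_space :: "'a topology \<Rightarrow> bool" where
  "totally_disconnected_space W \<longleftrightarrow> (\<forall>S. connectedin W S \<longrightarrow> (\<exists>a. S \<subseteq> {a}))"

definition omega_Stone_space :: "'a topology \<Rightarrow> bool" where
  "omega_Stone_space W \<longleftrightarrow> locally_compact_space W \<and> metrizable_space W \<and>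
     totally_disconnected_space W \<and> Hausdorff_space W"

function deriv_seq :: "'a topology \<Rightarrow> 'a ordinal \<Rightarrow> 'a set" where
  "deriv_seq W \<xi> =
     (if \<xi> = 0 then topspace W
      else if \<exists>\<eta>. \<xi> = osucc \<eta> then W derived_set_of (deriv_seq W (THE \<eta>. \<xi> = osucc \<eta>))
      else (\<Inter>\<eta>\<in>{..<\<xi>}. deriv_seq W \<eta>))"
  by auto
termination
proof (relation "inv_image {(\<xi>, \<eta>). \<xi> < \<eta>} snd")
  show "wf (inv_image {(\<xi>, \<eta> :: 'a ordinal). \<xi> < \<eta>} (snd :: 'a topology \<times> _ \<Rightarrow> _))"
    by (simp add: wf wf_inv_image)
qed auto

declare deriv_seq.simps [simp del]

lemma deriv_seq_zero: "deriv_seq W 0 = topspace W"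
  by (simp add: deriv_seq.simps)

lemma deriv_seq_succ: "deriv_seq W (osucc \<xi>) = W derived_set_of (deriv_seq W \<xi>)"
  by (subst deriv_seq.simps) auto

lemma deriv_seq_limit:
  "\<xi> \<noteq> 0 \<Longrightarrow> \<nexists>\<eta>. \<xi> = osucc \<eta> \<Longrightarrow> deriv_seq W \<xi> = (\<Inter>\<eta>\<in>{..<\<xi>}. deriv_seq W \<eta>)"
  by (subst deriv_seq.simps) auto

definition deriv_layer :: "'a topology \<Rightarrow> 'a ordinal \<Rightarrow> 'a set" where
  "deriv_layer W \<xi> = deriv_seq W \<xi> - deriv_seq W (osucc \<xi>)"

definition nu :: "'a topology \<Rightarrow> 'a ordinal" where
  "nu W = (LEAST \<xi>. deriv_seq W \<xi> = deriv_seq W (osucc \<xi>))"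

definition perfect_kernel :: "'a topology \<Rightarrow> 'a set" where
  "perfect_kernel W = deriv_seq W (nu W)"

definition lam :: "'a topology \<Rightarrow> 'a ordinal" where
  "lam W = (LEAST \<xi>. closedin W (deriv_seq W \<xi> - perfect_kernel W))"

definition n_inv :: "'a topology \<Rightarrow> ereal" where
  "n_inv W =
     (if \<exists>\<mu>. nu W = osucc \<mu> \<and> finite (deriv_seq W \<mu> - perfect_kernel W)
      then ereal (real (card (deriv_seq W (THE \<mu>. nu W = osucc \<mu>) - perfect_kernel W)))
      else - \<infinity>)"

text \<open>Only meaningful for points of \<^term>\<open>perfect_kernel W\<close>.\<close>

definition point_rank :: "'a topology \<Rightarrow> 'a \<Rightarrow> 'a ordinal" where
  "point_rank W x = (LEAST \<xi>. x \<notin> W closure_of (deriv_seq W \<xi> - perfect_kernel W))"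

definition kernel_above :: "'a topology \<Rightarrow> 'a ordinal \<Rightarrow> 'a set" where
  "kernel_above W \<xi> = {w \<in> perfect_kernel W. \<xi> < point_rank W w}"

definition rho :: "'a topology \<Rightarrow> 'a ordinal" where
  "rho W = (LEAST \<xi>. compactin W (W closure_of (deriv_layer W \<xi>)))"

definition rho_U :: "'a topology \<Rightarrow> 'a ordinal" where
  "rho_U W = (LEAST \<xi>. compactin W (kernel_above W \<xi>))"

definition CB_scattered :: "'a topology \<Rightarrow> bool" where
  "CB_scattered W \<longleftrightarrow> perfect_kernel W = {}"

definition CB_uniform :: "'a topology \<Rightarrow> bool" where
  "CB_uniform W \<longleftrightarrow> nu W = lam W"

definition strongly_uniform :: "'a topology \<Rightarrow> bool" where
  "strongly_uniform W \<longleftrightarrow> CB_uniform W \<and> rho_U W = rho W"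

datatype 'o space_type = Type_pair 'o 'o | Type_triple 'o 'o ereal

definition type_of_scattered :: "'a topology \<Rightarrow> 'a ordinal space_type" where
  "type_of_scattered W =
     (if rho W = nu W then Type_pair (nu W) (nu W) else Type_triple (nu W) (rho W) (n_inv W))"

definition scattered_of_type :: "'a topology \<Rightarrow> 'a ordinal space_type \<Rightarrow> bool" where
  "scattered_of_type W t \<longleftrightarrow> CB_scattered W \<and> type_of_scattered W = t"

definition clopen_in :: "'a topology \<Rightarrow> 'a set \<Rightarrow> bool" where
  "clopen_in W S \<longleftrightarrow> openin W S \<and> closedin W S"

definition clopen_sum :: "'a topology \<Rightarrow> 'a set \<Rightarrow> 'a set \<Rightarrow> bool" where
  "clopen_sum W X Y \<longleftrightarrow> clopen_in W X \<and> clopen_in W Y \<and> X \<inter> Y = {} \<and> X \<union> Y = topspace W"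


section \<open>The minima above are attained\<close>

lemma deriv_seq_succ_subset: "deriv_seq W (osucc \<xi>) \<subseteq> deriv_seq W \<xi>"
proof (induction \<xi> rule: less_induct)
  case (less \<xi>)
  consider "\<xi> = 0" | \<eta> where "\<xi> = osucc \<eta>" | "\<xi> \<noteq> 0" "\<nexists>\<eta>. \<xi> = osucc \<eta>" by blast
  then show ?case
  proof cases
    case 1
    then show ?thesis
      by (simp add: deriv_seq_succ deriv_seq_zero derived_set_of_subset_topspace)
  next
    case (2 \<eta>)
    then have "deriv_seq W \<xi> \<subseteq> deriv_seq W \<eta>" using less by auto
    then have "W derived_set_of deriv_seq W \<xi> \<subseteq> W derived_set_of deriv_seq W \<eta>"
      by (rule derived_set_of_mono)
    then show ?thesis using 2 by (simp add: deriv_seq_succ)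
  next
    case 3
    have "deriv_seq W (osucc \<xi>) \<subseteq> deriv_seq W \<eta>" if "\<eta> < \<xi>" for \<eta>
    proof -
      have "deriv_seq W (osucc \<xi>) \<subseteq> deriv_seq W (osucc \<eta>)"
        unfolding deriv_seq_succ
        by (rule derived_set_of_mono) (use 3 that deriv_seq_limit[of \<xi> W] in auto)
      then show ?thesis using less that by blast
    qed
    then show ?thesis using deriv_seq_limit[OF 3] by blast
  qed
qed

lemma deriv_seq_antimono: "\<eta> \<le> \<xi> \<Longrightarrow> deriv_seq W \<xi> \<subseteq> deriv_seq W \<eta>"
proof (induction \<xi> rule: less_induct)
  case (less \<xi>)
  show ?case
  proof (cases "\<eta> = \<xi>")
    case False
    then have lt: "\<eta> < \<xi>" using less.prems by simp
    show ?thesis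
    proof (cases "\<exists>\<zeta>. \<xi> = osucc \<zeta>")
      case True
      then obtain \<zeta> where z: "\<xi> = osucc \<zeta>" by blast
      then have "\<zeta> < \<xi>" "\<eta> \<le> \<zeta>" using lt by (auto simp only: less_osucc less_osucc_iff)
      then have "deriv_seq W \<zeta> \<subseteq> deriv_seq W \<eta>" by (rule less.IH)
      then show ?thesis unfolding z by (rule order_trans[OF deriv_seq_succ_subset])
    next
      case False
      moreover have "\<xi> \<noteq> 0" using lt by (metis leD ordinal_zero_le)
      ultimately have "deriv_seq W \<xi> = (\<Inter>\<zeta>\<in>{..<\<xi>}. deriv_seq W \<zeta>)"
        by (intro deriv_seq_limit)
      then show ?thesis using lt by blast
    qed
  qed simp
qed

lemma nu_attained: "deriv_seq W (nu W) = deriv_seq W (osucc (nu W))"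
proof -
  have "\<exists>\<xi>. deriv_seq W \<xi> = deriv_seq W (osucc \<xi>)"
  proof (rule ccontr)
    assume "\<nexists>\<xi>. deriv_seq W \<xi> = deriv_seq W (osucc \<xi>)"
    then have "\<forall>\<xi>. \<exists>x. x \<in> deriv_seq W \<xi> - deriv_seq W (osucc \<xi>)"
      using deriv_seq_succ_subset[of W] by blast
    then obtain f where f: "\<And>\<xi>. f \<xi> \<in> deriv_seq W \<xi> - deriv_seq W (osucc \<xi>)"
      by metis
    have "f \<xi> \<noteq> f \<eta>" if "\<xi> < \<eta>" for \<xi> \<eta>
      using f[of \<xi>] f[of \<eta>] deriv_seq_antimono[of "osucc \<xi>" \<eta> W] that
      by (auto simp: osucc_le_iff)
    then have "inj f" by (metis injI neqE)
    then show False using ordinal_no_inj by blast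
  qed
  then show ?thesis unfolding nu_def by (rule LeastI_ex)
qed

lemma lam_attained: "closedin W (deriv_seq W (lam W) - perfect_kernel W)"
proof -
  have "closedin W (deriv_seq W (nu W) - perfect_kernel W)"
    by (simp add: perfect_kernel_def)
  from LeastI[where P = "\<lambda>\<xi>. closedin W (deriv_seq W \<xi> - perfect_kernel W)", OF this]
  show ?thesis by (fold lam_def)
qed

lemma point_rank_attained:
  "x \<notin> W closure_of (deriv_seq W (point_rank W x) - perfect_kernel W)"
proof -
  have "x \<notin> W closure_of (deriv_seq W (nu W) - perfect_kernel W)"
    by (simp add: perfect_kernel_def)
  from LeastI[where P = "\<lambda>\<xi>. x \<notin> W closure_of (deriv_seq W \<xi> - perfect_kernel W)", OF this]
  show ?thesis by (fold point_rank_def)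
qed

lemma rho_attained: "compactin W (W closure_of (deriv_layer W (rho W)))"
proof -
  have "deriv_layer W (nu W) = {}"
    using nu_attained[of W] by (simp add: deriv_layer_def)
  then have "compactin W (W closure_of (deriv_layer W (nu W)))"
    by simp
  from LeastI[where P = "\<lambda>\<xi>. compactin W (W closure_of (deriv_layer W \<xi>))", OF this]
  show ?thesis by (fold rho_def)
qed

lemma rho_U_attained: "compactin W (kernel_above W (rho_U W))"
proof -
  have "point_rank W w \<le> nu W" for w
    unfolding point_rank_def by (rule Least_le) (simp add: perfect_kernel_def)
  then have "kernel_above W (nu W) = {}"
    by (auto simp: kernel_above_def not_less)
  then have "compactin W (kernel_above W (nu W))"
    by simp
  from LeastI[where P = "\<lambda>\<xi>. compactin W (kernel_above W \<xi>)", OF this]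
  show ?thesis by (fold rho_U_def)
qed

end

theory Submission
  imports Defs
begin

text \<open>
  Everything is expressed by the decreasing closed sets \<open>T \<xi> = cl (W\<^sup>(\<^sup>\<xi>\<^sup>) - K)\<close>. A point of \<open>W\<^sup>(\<^sup>\<xi>\<^sup>) - K\<close>
  has no neighbourhood missing the layer \<open>W\<^sup>[\<^sup>\<xi>\<^sup>]\<close>, so \<open>T \<xi>\<close> is also
  the closure of that layer. Hence \<open>\<rho> \<le> \<xi>\<close> means that \<open>T \<xi>\<close> is compact, \<open>\<rho>\<^sub>U \<le> \<xi>\<close> that \<open>K \<inter> T \<xi>\<close> is
  compact, and uniformity that \<open>T \<xi>\<close> meets \<open>K\<close> whenever it is nonempty; all of this restricts to clopen
  subspaces by intersection.

  If \<open>W\<close> is uniform with \<open>\<sigma> = \<rho>\<^sub>U < \<rho>\<close>, take a compact open \<open>A\<close> containing \<open>(K \<inter> T \<sigma>) \<union> T \<rho>\<close> and a clopen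
  \<open>Y\<close> that contains \<open>T \<sigma> - A\<close> and misses \<open>A \<union> K\<close>. Then \<open>T \<sigma> - Y\<close> is compact, so the complement \<open>X\<close> of \<open>Y\<close>
  is strongly uniform, while \<open>Y\<close> misses \<open>T \<rho>\<close> and carries the noncompactness of \<open>T \<xi>\<close> for \<open>\<sigma> \<le> \<xi> < \<rho>\<close>.
\<close>

section \<open>Derived sequence and invariants\<close>

lemma closedin_deriv_seq:
  assumes "t1_space W"
  shows "closedin W (deriv_seq W \<xi>)"
proof (induction \<xi> rule: less_induct)
  case (less \<xi>)
  consider "\<xi> = 0" | \<eta> where "\<xi> = osucc \<eta>" | "\<xi> \<noteq> 0" "\<nexists>\<eta>. \<xi> = osucc \<eta>" by blast
  then show ?case
  proof cases
    case 1
    then show ?thesis by (simp add: deriv_seq_zero)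
  next
    case (2 \<eta>)
    then show ?thesis
      using assms by (simp add: deriv_seq_succ closedin_derived_set_of_gen)
  next
    case 3
    then have "0 < \<xi>" by (metis ordinal_zero_le order_le_less)
    then show ?thesis
      using deriv_seq_limit[OF 3] less by auto
  qed
qed

text \<open>Derivation is local in the open set \<open>U\<close>. The hypothesis makes
  \<open>U \<inter> deriv_seq W \<xi>\<close> dense in itself, so no later derivation removes any of
  its points.\<close>

lemma deriv_seq_stable:
  assumes "U \<inter> deriv_seq W \<xi> \<subseteq> deriv_seq W (osucc \<xi>)" "openin W U" "\<xi> \<le> \<eta>"
  shows "U \<inter> deriv_seq W \<xi> \<subseteq> deriv_seq W \<eta>"
  using assms(3)
proof (induction \<eta> rule: less_induct)
  case (less \<eta>)
  consider "\<eta> = \<xi>" | "\<xi> < \<eta>" "\<eta> = 0" | \<zeta> where "\<xi> < \<eta>" "\<eta> = osucc \<zeta>"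
    | "\<eta> \<noteq> 0" "\<nexists>\<zeta>. \<eta> = osucc \<zeta>"
    using less.prems by force
  then show ?case
  proof cases
    case (3 \<zeta>)
    then have "\<xi> \<le> \<zeta>" "\<zeta> < \<eta>" by (auto simp: less_osucc_iff)
    then have "U \<inter> deriv_seq W \<xi> \<subseteq> deriv_seq W \<zeta>" using less.IH by blast
    then have "U \<inter> W derived_set_of (U \<inter> deriv_seq W \<xi>) \<subseteq> deriv_seq W \<eta>"
      using 3 by (metis deriv_seq_succ derived_set_of_mono inf.coboundedI2)
    moreover have "U \<inter> deriv_seq W \<xi> \<subseteq> U \<inter> W derived_set_of (deriv_seq W \<xi>)"
      using assms(1) by (auto simp: deriv_seq_succ)
    ultimately show ?thesis
      using openin_Int_derived_set_of_eq[OF assms(2), of "deriv_seq W \<xi>"] by blast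
  next
    case 4
    have "U \<inter> deriv_seq W \<xi> \<subseteq> deriv_seq W \<zeta>" if "\<zeta> < \<eta>" for \<zeta>
      using less.IH[OF that] deriv_seq_antimono[of \<zeta> \<xi> W] linear[of \<xi> \<zeta>] by blast
    then show ?thesis using deriv_seq_limit[OF 4] by blast
  next
    case 2
    then show ?thesis by (metis leD ordinal_zero_le)
  qed simp
qed

lemma perfect_kernel_subset: "perfect_kernel W \<subseteq> deriv_seq W \<xi>"
proof (cases "\<xi> \<le> nu W")
  case True
  then show ?thesis by (simp add: perfect_kernel_def deriv_seq_antimono)
next
  case False
  have "topspace W \<inter> deriv_seq W (nu W) \<subseteq> deriv_seq W \<xi>"
    by (rule deriv_seq_stable) (use False nu_attained[of W] in auto)
  moreover have "deriv_seq W (nu W) \<subseteq> topspace W"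
    by (metis deriv_seq_antimono deriv_seq_zero ordinal_zero_le)
  ultimately show ?thesis by (auto simp: perfect_kernel_def)
qed

lemma deriv_seq_subset_topspace: "deriv_seq W \<xi> \<subseteq> topspace W"
  by (metis deriv_seq_antimono deriv_seq_zero ordinal_zero_le)

lemma perfect_kernel_subset_topspace: "perfect_kernel W \<subseteq> topspace W"
  by (simp add: perfect_kernel_def deriv_seq_subset_topspace)

text \<open>Describes the kernel without \<open>nu W\<close>, which may differ between a space and
  its open subspaces.\<close>

lemma perfect_kernel_eq_INT: "perfect_kernel W = (\<Inter>\<xi>. deriv_seq W \<xi>)"
proof
  show "(\<Inter>\<xi>. deriv_seq W \<xi>) \<subseteq> perfect_kernel W"
    unfolding perfect_kernel_def by blast
qed (rule INT_greatest, rule perfect_kernel_subset)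

lemma nu_le_iff: "nu W \<le> \<xi> \<longleftrightarrow> deriv_seq W \<xi> = perfect_kernel W"
proof
  assume "nu W \<le> \<xi>"
  then show "deriv_seq W \<xi> = perfect_kernel W"
    using deriv_seq_antimono[of "nu W" \<xi> W] perfect_kernel_subset[of W \<xi>]
    by (auto simp: perfect_kernel_def)
next
  assume eq: "deriv_seq W \<xi> = perfect_kernel W"
  then have "deriv_seq W \<xi> = deriv_seq W (osucc \<xi>)"
    using perfect_kernel_subset[of W "osucc \<xi>"] deriv_seq_succ_subset[of W \<xi>] by simp
  then show "nu W \<le> \<xi>"
    unfolding nu_def by (rule Least_le)
qed

section \<open>Closures of the derived sets off the kernel\<close>

definition deriv_tail :: "'a topology \<Rightarrow> 'a ordinal \<Rightarrow> 'a set" where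
  "deriv_tail W \<xi> = W closure_of (deriv_seq W \<xi> - perfect_kernel W)"

lemma closedin_deriv_tail: "closedin W (deriv_tail W \<xi>)"
  by (simp add: deriv_tail_def)

lemma deriv_tail_antimono: "\<eta> \<le> \<xi> \<Longrightarrow> deriv_tail W \<xi> \<subseteq> deriv_tail W \<eta>"
  unfolding deriv_tail_def using deriv_seq_antimono[of \<eta> \<xi> W] by (intro closure_of_mono) auto

lemma deriv_tail_eq_empty_iff: "deriv_tail W \<xi> = {} \<longleftrightarrow> nu W \<le> \<xi>"
proof -
  have "deriv_tail W \<xi> = {} \<longleftrightarrow> deriv_seq W \<xi> \<subseteq> perfect_kernel W"
    unfolding deriv_tail_def using deriv_seq_subset_topspace[of W \<xi>]
    by (subst closure_of_eq_empty) auto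
  then show ?thesis
    using nu_le_iff[of W \<xi>] perfect_kernel_subset[of W \<xi>] by auto
qed

lemma closure_of_deriv_layer: "W closure_of (deriv_layer W \<xi>) = deriv_tail W \<xi>"
proof
  show "W closure_of (deriv_layer W \<xi>) \<subseteq> deriv_tail W \<xi>"
    unfolding deriv_tail_def deriv_layer_def
    using perfect_kernel_subset[of W "osucc \<xi>"] by (intro closure_of_mono) auto
  have "deriv_seq W \<xi> - perfect_kernel W \<subseteq> W closure_of (deriv_layer W \<xi>)"
  proof
    fix x assume x: "x \<in> deriv_seq W \<xi> - perfect_kernel W"
    \<comment> \<open>If \<open>U\<close> missed the layer, stability would put \<open>x\<close>
      into every derived set, hence into the kernel.\<close>
    have "\<exists>y. y \<in> deriv_layer W \<xi> \<and> y \<in> U" if U: "x \<in> U" "openin W U" for U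
    proof (rule ccontr)
      assume "\<nexists>y. y \<in> deriv_layer W \<xi> \<and> y \<in> U"
      then have "U \<inter> deriv_seq W \<xi> \<subseteq> deriv_seq W (osucc \<xi>)"
        by (auto simp: deriv_layer_def)
      from deriv_seq_stable[OF this U(2)] have "x \<in> deriv_seq W \<eta>" if "\<xi> \<le> \<eta>" for \<eta>
        using U x that by blast
      moreover have "x \<in> deriv_seq W \<eta>" if "\<eta> \<le> \<xi>" for \<eta>
        using x that deriv_seq_antimono by blast
      ultimately show False
        using x unfolding perfect_kernel_eq_INT by (metis DiffD2 INT_I linear)
    qed
    then show "x \<in> W closure_of (deriv_layer W \<xi>)"
      unfolding in_closure_of using x deriv_seq_subset_topspace[of W \<xi>] by auto
  qed
  then show "deriv_tail W \<xi> \<subseteq> W closure_of (deriv_layer W \<xi>)"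
    unfolding deriv_tail_def by (simp add: closure_of_minimal)
qed

text \<open>Turns invariants defined as minima into thresholds: comparing such an invariant with
  \<xi> becomes a condition on sets, which can be restricted to subspaces. The witness
  \<open>k\<close> guarantees that the minimum is attained.\<close>

lemma Least_le_iff_antimono:
  fixes P :: "'b::wellorder \<Rightarrow> bool"
  assumes "\<And>i j. i \<le> j \<Longrightarrow> P i \<Longrightarrow> P j" "P k"
  shows "(LEAST i. P i) \<le> i \<longleftrightarrow> P i"
proof
  have "P (LEAST i. P i)" using LeastI[of P, OF assms(2)] .
  then show "P i" if "(LEAST i. P i) \<le> i"
    using assms(1)[OF that] by blast
qed (rule Least_le)

lemma rho_le_iff: "rho W \<le> \<xi> \<longleftrightarrow> compactin W (deriv_tail W \<xi>)"
  unfolding rho_def closure_of_deriv_layer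
proof (rule Least_le_iff_antimono)
  show "compactin W (deriv_tail W j)" if "i \<le> j" "compactin W (deriv_tail W i)" for i j
    by (rule closed_compactin[OF that(2) deriv_tail_antimono[OF that(1)] closedin_deriv_tail])
  show "compactin W (deriv_tail W (rho W))"
    using rho_attained by (simp add: closure_of_deriv_layer)
qed

lemma rho_le_nu: "rho W \<le> nu W"
  using deriv_tail_eq_empty_iff[of W "nu W"] by (simp add: rho_le_iff)

text \<open>Since the tails decrease, the indices of those containing a given point form an initial
  segment, and \<open>point_rank\<close> is the first index beyond it.\<close>

lemma kernel_above_eq: "kernel_above W \<xi> = perfect_kernel W \<inter> deriv_tail W \<xi>"
proof -
  have "point_rank W w \<le> \<xi> \<longleftrightarrow> w \<notin> deriv_tail W \<xi>" for w
    unfolding point_rank_def deriv_tail_def[symmetric]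
  proof (rule Least_le_iff_antimono)
    show "w \<notin> deriv_tail W (point_rank W w)"
      using point_rank_attained by (simp add: deriv_tail_def)
  qed (use deriv_tail_antimono[of _ _ W] in blast)
  then have "\<xi> < point_rank W w \<longleftrightarrow> w \<in> deriv_tail W \<xi>" for w
    by (metis not_le)
  then show ?thesis
    by (auto simp: kernel_above_def)
qed

lemma closedin_perfect_kernel: "t1_space W \<Longrightarrow> closedin W (perfect_kernel W)"
  unfolding perfect_kernel_def by (rule closedin_deriv_seq)

lemma rho_U_le_iff:
  assumes "t1_space W"
  shows "rho_U W \<le> \<xi> \<longleftrightarrow> compactin W (perfect_kernel W \<inter> deriv_tail W \<xi>)"
  unfolding rho_U_def kernel_above_eq
proof (rule Least_le_iff_antimono)
  show "compactin W (perfect_kernel W \<inter> deriv_tail W j)"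
    if "i \<le> j" "compactin W (perfect_kernel W \<inter> deriv_tail W i)" for i j
  proof (rule closed_compactin[OF that(2)])
    show "perfect_kernel W \<inter> deriv_tail W j \<subseteq> perfect_kernel W \<inter> deriv_tail W i"
      using deriv_tail_antimono[OF that(1), of W] by blast
  qed (simp add: closedin_Int closedin_perfect_kernel[OF assms] closedin_deriv_tail)
  show "compactin W (perfect_kernel W \<inter> deriv_tail W (rho_U W))"
    using rho_U_attained by (simp add: kernel_above_eq)
qed

text \<open>A compact tail meets the closed kernel in a compact set. Hence a uniform space that is
  not strongly uniform satisfies the strict inequality.\<close>

lemma rho_U_le_rho:
  assumes "t1_space W"
  shows "rho_U W \<le> rho W"
proof -
  have "compactin W (deriv_tail W (rho W))"
    using rho_le_iff by blast
  then show ?thesis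
    unfolding rho_U_le_iff[OF assms]
    by (rule closed_compactin)
      (simp_all add: closedin_Int closedin_perfect_kernel[OF assms] closedin_deriv_tail)
qed

text \<open>As derived sets are closed, the tail lies between
  \<open>deriv_seq W \<xi> - perfect_kernel W\<close> and \<open>deriv_seq W \<xi>\<close>; taking
  the closure can only add kernel points.\<close>

lemma closedin_deriv_seq_minus_kernel_iff:
  assumes "t1_space W"
  shows "closedin W (deriv_seq W \<xi> - perfect_kernel W) \<longleftrightarrow> perfect_kernel W \<inter> deriv_tail W \<xi> = {}"
proof -
  have "deriv_tail W \<xi> \<subseteq> deriv_seq W \<xi>"
    unfolding deriv_tail_def by (simp add: assms closedin_deriv_seq closure_of_minimal)
  moreover have "deriv_seq W \<xi> - perfect_kernel W \<subseteq> deriv_tail W \<xi>"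
    unfolding deriv_tail_def using deriv_seq_subset_topspace[of W \<xi>]
    by (intro closure_of_subset) auto
  ultimately have "deriv_tail W \<xi> = deriv_seq W \<xi> - perfect_kernel W
      \<longleftrightarrow> perfect_kernel W \<inter> deriv_tail W \<xi> = {}"
    by blast
  then show ?thesis
    using closure_of_eq[of W "deriv_seq W \<xi> - perfect_kernel W"] by (simp add: deriv_tail_def)
qed

text \<open>\<open>lam W\<close> is the threshold from which tails miss the kernel,
  \<open>nu W\<close> the one from which they are empty. The first never exceeds the second, so they
  agree unless some nonempty tail misses the kernel.\<close>

lemma CB_uniform_iff:
  assumes "t1_space W"
  shows "CB_uniform W \<longleftrightarrow> (\<forall>\<xi>. deriv_tail W \<xi> \<noteq> {} \<longrightarrow> perfect_kernel W \<inter> deriv_tail W \<xi> \<noteq> {})"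
proof -
  have lam: "lam W \<le> \<xi> \<longleftrightarrow> perfect_kernel W \<inter> deriv_tail W \<xi> = {}" for \<xi>
    unfolding lam_def closedin_deriv_seq_minus_kernel_iff[OF assms]
  proof (rule Least_le_iff_antimono)
    show "perfect_kernel W \<inter> deriv_tail W (nu W) = {}"
      using deriv_tail_eq_empty_iff[of W "nu W"] by auto
  qed (use deriv_tail_antimono[of _ _ W] in blast)
  then have "lam W \<le> nu W"
    using deriv_tail_eq_empty_iff[of W "nu W"] by auto
  then have "CB_uniform W \<longleftrightarrow> (\<forall>\<xi><nu W. \<not> lam W \<le> \<xi>)"
    unfolding CB_uniform_def by (metis leD leI le_less)
  then show ?thesis by (simp add: lam deriv_tail_eq_empty_iff not_le)
qed

section \<open>Restriction to open subspaces\<close>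

lemma deriv_seq_subtopology_open:
  assumes "openin W S"
  shows "deriv_seq (subtopology W S) \<xi> = S \<inter> deriv_seq W \<xi>"
proof (induction \<xi> rule: less_induct)
  case (less \<xi>)
  consider "\<xi> = 0" | \<eta> where "\<xi> = osucc \<eta>" | "\<xi> \<noteq> 0" "\<nexists>\<eta>. \<xi> = osucc \<eta>" by blast
  then show ?case
  proof cases
    case 1
    then show ?thesis by (auto simp: deriv_seq_zero)
  next
    case (2 \<eta>)
    then have "deriv_seq (subtopology W S) \<eta> = S \<inter> deriv_seq W \<eta>"
      using less by simp
    then show ?thesis
      by (simp add: 2 deriv_seq_succ derived_set_of_subtopology
          openin_Int_derived_set_of_eq[OF assms, of "deriv_seq W \<eta>"])
  next
    case 3
    \<comment> \<open>Makes the range of indices nonempty; over an empty one, intersecting with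
      \<open>S\<close> would not commute with the intersection.\<close>
    then have "0 < \<xi>" by (metis ordinal_zero_le order_le_less)
    then show ?thesis
      using less by (auto simp: deriv_seq_limit[OF 3])
  qed
qed

lemma perfect_kernel_subtopology_open:
  "openin W S \<Longrightarrow> perfect_kernel (subtopology W S) = S \<inter> perfect_kernel W"
  by (auto simp: perfect_kernel_eq_INT deriv_seq_subtopology_open)

lemma deriv_tail_subtopology_open:
  assumes "openin W S"
  shows "deriv_tail (subtopology W S) \<xi> = S \<inter> deriv_tail W \<xi>"
proof -
  have "deriv_seq (subtopology W S) \<xi> - perfect_kernel (subtopology W S)
        = S \<inter> (deriv_seq W \<xi> - perfect_kernel W)"
    using assms by (auto simp: deriv_seq_subtopology_open perfect_kernel_subtopology_open)
  then show ?thesis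
    by (simp add: deriv_tail_def closure_of_subtopology
        openin_Int_closure_of_eq[OF assms, of "deriv_seq W \<xi> - perfect_kernel W"])
qed

section \<open>Separation by clopen sets\<close>

text \<open>The component of \<open>x\<close> is \<open>{x}\<close>, and a compact component of a
  locally compact Hausdorff space has arbitrarily small clopen neighbourhoods. Those inside a
  compact set are compact.\<close>

lemma compact_open_neighbourhood:
  assumes "locally_compact_space W" "Hausdorff_space W" "totally_disconnected_space W"
    and "openin W U" "x \<in> U"
  obtains V where "openin W V" "compactin W V" "x \<in> V" "V \<subseteq> U"
proof -
  have x: "x \<in> topspace W"
    using assms openin_subset by blast
  then obtain N K where NK: "openin W N" "compactin W K" "x \<in> N" "N \<subseteq> K"
    using assms(1) unfolding locally_compact_space_def by blast
  let ?C = "connected_component_of_set W x"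
  have "connectedin W ?C"
    by (rule connectedin_connected_component_of)
  then obtain a where "?C \<subseteq> {a}"
    using assms(3) unfolding totally_disconnected_space_def by blast
  moreover have "x \<in> ?C"
    using x by (simp add: connected_component_of_refl)
  ultimately have C: "?C = {x}"
    by blast
  have comp: "?C \<in> connected_components_of W"
    using x by (simp add: connected_component_in_connected_components_of)
  have "compactin W ?C" "openin W (N \<inter> U)" "?C \<subseteq> N \<inter> U"
    using C x NK assms by auto
  from wilder_locally_compact_component_thm[OF assms(1,2) comp this]
  obtain V V' where V: "openin W V" "openin W V'" "disjnt V V'" "V \<union> V' = topspace W"
    "?C \<subseteq> V" "V \<subseteq> N \<inter> U"
    by blast
  have "topspace W - V = V'" "V \<subseteq> topspace W"
    using V(3,4) unfolding disjnt_def by blast+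
  then have "closedin W V"
    using V(2) by (simp add: closedin_def)
  moreover have "V \<subseteq> K"
    using NK(4) V(6) by blast
  ultimately have cpt: "compactin W V"
    using closed_compactin[OF NK(2)] by blast
  have "x \<in> V" "V \<subseteq> U"
    using V(5,6) C by blast+
  then show thesis
    by (rule that[OF V(1) cpt])
qed

lemma compact_open_between:
  assumes "locally_compact_space W" "Hausdorff_space W" "totally_disconnected_space W"
    and "compactin W C" "openin W U" "C \<subseteq> U"
  obtains V where "openin W V" "compactin W V" "C \<subseteq> V" "V \<subseteq> U"
proof -
  let ?\<V> = "{V. openin W V \<and> compactin W V \<and> V \<subseteq> U}"
  have "C \<subseteq> \<Union>?\<V>"
  proof
    fix x assume "x \<in> C"
    then obtain V where "openin W V" "compactin W V" "x \<in> V" "V \<subseteq> U"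
      using compact_open_neighbourhood[OF assms(1-3,5)] assms(6) by blast
    then show "x \<in> \<Union>?\<V>" by blast
  qed
  then obtain \<F> where \<F>: "finite \<F>" "\<F> \<subseteq> ?\<V>" "C \<subseteq> \<Union>\<F>"
    using compactinD[OF assms(4), of ?\<V>] by blast
  show thesis
  proof
    show "openin W (\<Union>\<F>)" using \<F> by blast
    show "compactin W (\<Union>\<F>)" using \<F> by (intro compactin_Union) auto
  qed (use \<F> in auto)
qed

text \<open>
  The relation joins points whose distance is small compared with the radius up to which balls
  around one of them are relatively compact. Its reflexive transitive closure partitions the space
  into clopen \<open>\<sigma>\<close>-compact classes, which replaces paracompactness for non-separable spaces.
\<close>

lemma (in Metric_space) compact_controlled_relation:
  assumes "locally_compact_space mtopology"
  obtains E where "sym E" "\<And>x. x \<in> M \<Longrightarrow> \<exists>U. openin mtopology U \<and> x \<in> U \<and> U \<subseteq> E `` {x}"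
    "\<And>C. compactin mtopology C \<Longrightarrow> \<exists>C'. compactin mtopology C' \<and> E `` C \<subseteq> C'"
proof -
  \<comment> \<open>The bound by 1 keeps the supremum finite when arbitrarily large balls are relatively compact.\<close>
  define S where "S x = {t. 0 < t \<and> t \<le> 1 \<and> (\<exists>K. compactin mtopology K \<and> mball x t \<subseteq> K)}" for x
  define s where "s x = Sup (S x)" for x
  have bdd: "bdd_above (S x)" for x
    by (auto simp: S_def intro: bdd_aboveI[of _ 1])
  have ne: "S x \<noteq> {}" if "x \<in> M" for x
  proof -
    obtain U K where UK: "openin mtopology U" "compactin mtopology K" "x \<in> U" "U \<subseteq> K"
      using assms \<open>x \<in> M\<close> unfolding locally_compact_space_def by auto
    then obtain r where "r > 0" "mball x r \<subseteq> U"
      unfolding openin_mtopology by blast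
    then have "min r 1 \<in> S x"
      unfolding S_def using UK mball_subset_concentric[of "min r 1" r x] by auto
    then show ?thesis by blast
  qed
  have pos: "0 < s x" if x: "x \<in> M" for x
  proof -
    obtain t where "t \<in> S x" using ne[OF x] by blast
    then show ?thesis
      using cSup_upper[OF _ bdd, of t x] unfolding s_def S_def by auto
  qed
  have rel_compact: "\<exists>K. compactin mtopology K \<and> mball x t \<subseteq> K" if x: "x \<in> M" and t: "t < s x" for x t
  proof -
    obtain u where "u \<in> S x" "t < u"
      using less_cSupD[OF ne[OF x] t[unfolded s_def]] by blast
    then show ?thesis
      unfolding S_def using mball_subset_concentric[of t u x] by force
  qed
  \<comment> \<open>The radius function is 1-Lipschitz: for \<open>t > d x y\<close> the ball of
    radius \<open>t - d x y\<close> around \<open>y\<close> lies in the ball of radius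
    \<open>t\<close> around \<open>x\<close>.\<close>
  have lip: "s x \<le> s y + d x y" if xy: "x \<in> M" "y \<in> M" for x y
    unfolding s_def[of x]
  proof (rule cSup_least[OF ne[OF xy(1)]])
    fix t assume t: "t \<in> S x"
    show "t \<le> s y + d x y"
    proof (cases "t \<le> d x y")
      case True
      then show ?thesis using pos[OF xy(2)] by linarith
    next
      case False
      have "mball y (t - d x y) \<subseteq> mball x t"
        by (rule mball_subset) (use xy in \<open>auto simp: commute\<close>)
      moreover obtain K where "compactin mtopology K" "mball x t \<subseteq> K"
        using t unfolding S_def by blast
      moreover have "0 < t - d x y" "t - d x y \<le> 1"
        using t False nonneg[of x y] by (auto simp: S_def intro: order_trans[of _ t])
      ultimately have "t - d x y \<in> S y"
        unfolding S_def by blast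
      then have "t - d x y \<le> s y"
        unfolding s_def by (rule cSup_upper[OF _ bdd])
      then show ?thesis by linarith
    qed
  qed
  \<comment> \<open>The maximum makes the relation symmetric. The factor 1/4 is small enough for the
    Lipschitz bound to control \<open>d x y\<close> by the radius at either point alone.\<close>
  define E where "E = {(x, y). x \<in> M \<and> y \<in> M \<and> d x y < max (s x) (s y) / 4}"
  show thesis
  proof
    show "sym E"
      unfolding E_def sym_def by (auto simp: commute max.commute)
    show "\<exists>U. openin mtopology U \<and> x \<in> U \<and> U \<subseteq> E `` {x}" if "x \<in> M" for x
      using that pos[OF that] by (intro exI[of _ "mball x (s x / 4)"]) (auto simp: E_def)
    fix C assume C: "compactin mtopology C"
    have CM: "C \<subseteq> M" using compactin_subset_topspace[OF C] by simp
    have "C \<subseteq> \<Union>((\<lambda>x. mball x (s x / 10)) ` C)"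
      using CM pos by fastforce
    then have "\<exists>\<F>. finite \<F> \<and> \<F> \<subseteq> (\<lambda>x. mball x (s x / 10)) ` C \<and> C \<subseteq> \<Union>\<F>"
      by (rule compactinD[OF C, rotated]) auto
    then obtain \<F> where \<F>: "finite \<F>" "\<F> \<subseteq> (\<lambda>x. mball x (s x / 10)) ` C" "C \<subseteq> \<Union>\<F>"
      by (elim exE conjE)
    then obtain D where D: "D \<subseteq> C" "finite D" "\<F> = (\<lambda>x. mball x (s x / 10)) ` D"
      using finite_subset_image[OF \<F>(1,2)] by blast
    then have CD: "C \<subseteq> (\<Union>x\<in>D. mball x (s x / 10))"
      using \<F>(3) by simp
    \<comment> \<open>A factor below 1 gives relative compactness, and 9/10 leaves room: points
      related to the small ball around \<open>x\<close> are within
      \<open>(1/10 + 11/30) * s x\<close>.\<close>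
    have "\<exists>K. compactin mtopology K \<and> mball x (9 / 10 * s x) \<subseteq> K" if "x \<in> D" for x
    proof (rule rel_compact)
      show "x \<in> M" using that D(1) CM by blast
      then show "9 / 10 * s x < s x" using pos[of x] by simp
    qed
    then obtain K where K: "\<And>x. x \<in> D \<Longrightarrow> compactin mtopology (K x)"
      "\<And>x. x \<in> D \<Longrightarrow> mball x (9 / 10 * s x) \<subseteq> K x"
      by metis
    have "E `` C \<subseteq> (\<Union>x\<in>D. K x)"
    proof
      fix y assume "y \<in> E `` C"
      then obtain z where z: "z \<in> C" "y \<in> M" "d z y < max (s z) (s y) / 4"
        unfolding E_def by blast
      then obtain x where x: "x \<in> D" "d x z < s x / 10" "x \<in> M" "z \<in> M"
        using CD by auto
      \<comment> \<open>If \<open>s y\<close> is the maximum, then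
        \<open>d z y < (s z + d z y) / 4\<close>, which rearranges to this bound.\<close>
      have "d z y < s z / 3"
        using lip[OF \<open>y \<in> M\<close> \<open>z \<in> M\<close>] z(3) pos[OF \<open>z \<in> M\<close>] commute[of z y] by linarith
      moreover have "s z \<le> s x + d x z"
        using lip[OF \<open>z \<in> M\<close> \<open>x \<in> M\<close>] commute[of z x] by linarith
      moreover have "d x y \<le> d x z + d z y"
        using triangle x z by blast
      ultimately have "d x y < 9 / 10 * s x"
        using x(2) pos[OF \<open>x \<in> M\<close>] by linarith
      then have "y \<in> mball x (9 / 10 * s x)"
        using x z by simp
      then show "y \<in> (\<Union>x\<in>D. K x)"
        using K(2) x(1) by blast
    qed
    moreover have "compactin mtopology (\<Union>x\<in>D. K x)"
      using K(1) D(2) by (intro compactin_Union) auto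
    ultimately show "\<exists>C'. compactin mtopology C' \<and> E `` C \<subseteq> C'"
      by blast
  qed
qed

text \<open>Making the countable compact open cover disjoint splits \<open>Q\<close> into open
  pieces; choices made in different pieces do not interfere. Openness of \<open>Q - Y\<close> is
  recorded because it survives gluing over infinitely many classes.\<close>

lemma clopen_separation_sigma_compact:
  fixes U :: "nat \<Rightarrow> 'a set"
  assumes W: "locally_compact_space W" "Hausdorff_space W" "totally_disconnected_space W"
    and Q: "openin W Q" "Q \<subseteq> (\<Union>n. U n)"
    and U: "\<And>n. openin W (U n)" "\<And>n. compactin W (U n)"
    and FG: "closedin W F" "closedin W G" "F \<inter> G = {}"
  obtains Y where "Y \<subseteq> Q" "openin W Y" "openin W (Q - Y)" "F \<inter> Q \<subseteq> Y" "Y \<inter> G = {}"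
proof -
  have "\<exists>Z. openin W Z \<and> compactin W Z \<and> F \<inter> U n \<subseteq> Z \<and> Z \<inter> G = {}" for n
  proof -
    have "compactin W (F \<inter> U n)"
      using FG(1) U(2) closed_Int_compactin by blast
    moreover have "openin W (topspace W - G)"
      using FG(2) by blast
    moreover have "F \<inter> U n \<subseteq> topspace W - G"
      using FG closedin_subset by blast
    ultimately show ?thesis
      by (rule compact_open_between[OF W]) blast
  qed
  then obtain Z where Z: "\<And>n. openin W (Z n)" "\<And>n. compactin W (Z n)"
    "\<And>n. F \<inter> U n \<subseteq> Z n" "\<And>n. Z n \<inter> G = {}"
    by metis
  define V where "V n = Q \<inter> U n - (\<Union>m<n. U m)" for n
  have openV: "openin W (V n)" for n
    unfolding V_def
  proof (rule openin_diff)
    show "closedin W (\<Union>m<n. U m)"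
      using U(2) W(2) by (intro closedin_Union) (auto intro: compactin_imp_closedin)
  qed (use Q(1) U(1) in blast)
  have disjV: "m = n" if "x \<in> V m" "x \<in> V n" for x m n
    using that unfolding V_def by (metis DiffE IntE UN_I lessThan_iff linorder_neqE_nat)
  have coverV: "(\<Union>n. V n) = Q"
  proof
    show "Q \<subseteq> (\<Union>n. V n)"
    proof
      fix x assume x: "x \<in> Q"
      then have ex: "\<exists>n. x \<in> U n" using Q(2) by blast
      define k where "k = (LEAST n. x \<in> U n)"
      have "x \<in> U k" using LeastI_ex[OF ex] by (simp add: k_def)
      moreover have "x \<notin> U m" if "m < k" for m
        using that not_less_Least unfolding k_def by blast
      ultimately have "x \<in> V k"
        using x by (auto simp: V_def)
      then show "x \<in> (\<Union>n. V n)" by blast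
    qed
  qed (auto simp: V_def)
  define Y where "Y = (\<Union>n. V n \<inter> Z n)"
  have compl: "Q - Y = (\<Union>n. V n - Z n)"
    using disjV coverV unfolding Y_def by blast
  show thesis
  proof
    show "Y \<subseteq> Q" using coverV by (auto simp: Y_def)
    show "openin W Y" unfolding Y_def using openV Z(1) by blast
    have "openin W (V n - Z n)" for n
      using openV Z(2) W(2) by (simp add: compactin_imp_closedin openin_diff)
    then show "openin W (Q - Y)" unfolding compl by blast
    show "F \<inter> Q \<subseteq> Y"
    proof
      fix x assume x: "x \<in> F \<inter> Q"
      then obtain n where n: "x \<in> V n" using coverV by blast
      then have "x \<in> Z n" using x Z(3) by (auto simp: V_def)
      then show "x \<in> Y" using n by (auto simp: Y_def)
    qed
    show "Y \<inter> G = {}" using Z(4) by (auto simp: Y_def)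
  qed
qed

text \<open>Large inductive dimension zero, wanted because the closed sets to be separated need not
  be compact. The separation is done in each class of the controlled relation and then
  glued.\<close>

lemma omega_Stone_clopen_separation:
  assumes "omega_Stone_space W" and FG: "closedin W F" "closedin W G" "F \<inter> G = {}"
  obtains Y where "clopen_in W Y" "F \<subseteq> Y" "Y \<inter> G = {}"
proof -
  have W: "locally_compact_space W" "Hausdorff_space W" "totally_disconnected_space W"
    and "metrizable_space W"
    using assms(1) by (auto simp: omega_Stone_space_def)
  then obtain M d where Md: "Metric_space M d" "W = Metric_space.mtopology M d"
    unfolding metrizable_space_def by blast
  obtain E where E: "sym E" "\<And>x. x \<in> topspace W \<Longrightarrow> \<exists>U. openin W U \<and> x \<in> U \<and> U \<subseteq> E `` {x}"
    "\<And>C. compactin W C \<Longrightarrow> \<exists>C'. compactin W C' \<and> E `` C \<subseteq> C'"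
    using Metric_space.compact_controlled_relation[OF Md(1)] W(1)
    unfolding Md(2) Metric_space.topspace_mtopology[OF Md(1)] by blast
  define cls where "cls x = topspace W \<inter> E\<^sup>* `` {x}" for x
  have cls_eq: "cls x = cls y" if "y \<in> cls x" for x y
  proof -
    have "(x, y) \<in> E\<^sup>*" "(y, x) \<in> E\<^sup>*"
      using that sym_rtrancl[OF E(1)] by (auto simp: cls_def dest: symD)
    then show ?thesis
      unfolding cls_def by (auto intro: rtrancl_trans)
  qed
  have self: "x \<in> cls x" if "x \<in> topspace W" for x
    using that by (simp add: cls_def)
  have cls_open: "openin W (cls x)" for x
  proof (subst openin_subopen, intro ballI)
    fix y assume y: "y \<in> cls x"
    then obtain U where U: "openin W U" "y \<in> U" "U \<subseteq> E `` {y}"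
      using E(2)[of y] by (auto simp: cls_def)
    then have "U \<subseteq> cls y"
      using openin_subset[OF U(1)] by (auto simp: cls_def)
    then show "\<exists>T. openin W T \<and> y \<in> T \<and> T \<subseteq> cls x"
      using U cls_eq[OF y] by blast
  qed
  have step: "\<exists>B. openin W B \<and> compactin W B \<and> E `` A \<inter> topspace W \<subseteq> B" if A: "compactin W A" for A
  proof -
    obtain C where C: "compactin W C" "E `` A \<subseteq> C" using E(3)[OF A] by blast
    from compact_open_between[OF W C(1) openin_topspace compactin_subset_topspace[OF C(1)]]
    show ?thesis using C(2) by (metis inf.coboundedI1 order_trans)
  qed
  then obtain g where g: "\<And>A. compactin W A \<Longrightarrow> openin W (g A) \<and> compactin W (g A)
      \<and> E `` A \<inter> topspace W \<subseteq> g A"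
    by metis
  have sep: "\<exists>Y. Y \<subseteq> Q \<and> openin W Y \<and> openin W (Q - Y) \<and> F \<inter> Q \<subseteq> Y \<and> Y \<inter> G = {}"
    if Q: "Q \<in> cls ` topspace W" for Q
  proof -
    obtain x where x: "x \<in> topspace W" "Q = cls x" using Q by blast
    obtain A where A: "openin W A" "compactin W A" "x \<in> A"
      using compact_open_neighbourhood[OF W openin_topspace x(1)] by blast
    \<comment> \<open>\<open>U n\<close> is compact open and contains every point reached from
      \<open>x\<close> by \<open>n\<close> steps of \<open>E\<close>, so these sets exhaust the
      class.\<close>
    define U where "U n = (g ^^ n) A" for n
    have U: "openin W (U n) \<and> compactin W (U n)" for n
      by (induction n) (use A g in \<open>auto simp: U_def\<close>)
    have Esub: "b \<in> topspace W" if "(a, b) \<in> E" "a \<in> topspace W" for a b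
      using E(3)[of "{a}"] that compactin_subset_topspace by fastforce
    have "\<exists>n. y \<in> U n \<and> y \<in> topspace W" if "(x, y) \<in> E\<^sup>*" for y
      using that
    proof (induction rule: rtrancl_induct)
      case base
      then show ?case using x A by (intro exI[of _ 0]) (simp add: U_def)
    next
      case (step y z)
      then obtain n where n: "y \<in> U n" "y \<in> topspace W" by blast
      have z: "z \<in> topspace W" using Esub step n by blast
      then have "z \<in> g (U n)"
        using g[of "U n"] U[of n] n step by blast
      then have "z \<in> U (Suc n)"
        by (simp add: U_def)
      then show ?case using z by blast
    qed
    then have "Q \<subseteq> (\<Union>n. U n)"
      by (auto simp: x cls_def)
    then show ?thesis
      using clopen_separation_sigma_compact[OF W, of Q U F G] cls_open U FG x(2) by metis
  qed
  then obtain Y where Y: "\<And>Q. Q \<in> cls ` topspace W \<Longrightarrow> Y Q \<subseteq> Q \<and> openin W (Y Q) \<and> openin W (Q - Y Q)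
      \<and> F \<inter> Q \<subseteq> Y Q \<and> Y Q \<inter> G = {}"
    by metis
  define Z where "Z = (\<Union>Q \<in> cls ` topspace W. Y Q)"
  \<comment> \<open>Classes are equal or disjoint, so a point outside the chosen part of its own
    class lies in no other chosen part.\<close>
  have compl: "topspace W - Z = (\<Union>Q \<in> cls ` topspace W. Q - Y Q)"
  proof (intro equalityI subsetI)
    fix x assume "x \<in> topspace W - Z"
    then show "x \<in> (\<Union>Q \<in> cls ` topspace W. Q - Y Q)"
      using self by (auto simp: Z_def)
  next
    fix x assume "x \<in> (\<Union>Q \<in> cls ` topspace W. Q - Y Q)"
    then obtain a where a: "a \<in> topspace W" "x \<in> cls a" "x \<notin> Y (cls a)" by blast
    have "x \<notin> Y (cls b)" if "b \<in> topspace W" for b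
    proof
      assume x: "x \<in> Y (cls b)"
      then have "x \<in> cls b" using Y that by blast
      then have "cls a = cls b" using cls_eq a by metis
      then show False using x a by simp
    qed
    then show "x \<in> topspace W - Z"
      using a by (auto simp: Z_def cls_def)
  qed
  show thesis
  proof
    have "openin W Z" unfolding Z_def using Y by blast
    moreover have "openin W (topspace W - Z)" unfolding compl using Y by blast
    ultimately show "clopen_in W Z"
      unfolding clopen_in_def closedin_def using openin_subset by blast
    show "F \<subseteq> Z"
    proof
      fix x assume x: "x \<in> F"
      then have xW: "x \<in> topspace W" using FG(1) closedin_subset by blast
      then have "x \<in> Y (cls x)" using Y[of "cls x"] self x by blast
      then show "x \<in> Z" using xW by (auto simp: Z_def)
    qed
    show "Z \<inter> G = {}" using Y by (auto simp: Z_def)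
  qed
qed

section \<open>Decomposition of uniform spaces\<close>

lemma scattered_of_type_pair_iff:
  "scattered_of_type W (Type_pair \<rho> \<rho>) \<longleftrightarrow> perfect_kernel W = {} \<and> nu W = \<rho> \<and> rho W = \<rho>"
  by (auto simp: scattered_of_type_def CB_scattered_def type_of_scattered_def)

section \<open>Invariants of open subspaces, read off in the whole space\<close>

lemma nu_subtopology_le_iff:
  "openin W S \<Longrightarrow> nu (subtopology W S) \<le> \<xi> \<longleftrightarrow> S \<inter> deriv_tail W \<xi> = {}"
  by (simp add: deriv_tail_eq_empty_iff[symmetric] deriv_tail_subtopology_open)

lemma rho_subtopology_le_iff:
  "openin W S \<Longrightarrow> rho (subtopology W S) \<le> \<xi> \<longleftrightarrow> compactin W (S \<inter> deriv_tail W \<xi>)"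
  by (simp add: rho_le_iff deriv_tail_subtopology_open compactin_subtopology)

lemma rho_U_subtopology_le_iff:
  assumes "t1_space W" "openin W S"
  shows "rho_U (subtopology W S) \<le> \<xi>
    \<longleftrightarrow> compactin W (S \<inter> (perfect_kernel W \<inter> deriv_tail W \<xi>))"
proof -
  have "(S \<inter> perfect_kernel W) \<inter> (S \<inter> deriv_tail W \<xi>) = S \<inter> (perfect_kernel W \<inter> deriv_tail W \<xi>)"
    by blast
  then show ?thesis
    using assms
    by (simp add: rho_U_le_iff t1_space_subtopology deriv_tail_subtopology_open
        perfect_kernel_subtopology_open compactin_subtopology)
qed

lemma uniform_subtopology_iff:
  assumes "t1_space W" "openin W S"
  shows "CB_uniform (subtopology W S) \<longleftrightarrow>
    (\<forall>\<xi>. S \<inter> deriv_tail W \<xi> \<noteq> {} \<longrightarrow> S \<inter> (perfect_kernel W \<inter> deriv_tail W \<xi>) \<noteq> {})"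
proof -
  have "(S \<inter> perfect_kernel W) \<inter> (S \<inter> deriv_tail W \<xi>) = S \<inter> (perfect_kernel W \<inter> deriv_tail W \<xi>)" for \<xi>
    by blast
  then show ?thesis
    using assms
    by (simp add: CB_uniform_iff t1_space_subtopology deriv_tail_subtopology_open
        perfect_kernel_subtopology_open)
qed

text \<open>The tails meet \<open>Y\<close> only below
  \<open>\<rho> \<le> nu (subtopology W X)\<close>, where they also meet \<open>X\<close> and hence
  the kernel. From \<rho> on both parts of a tail are compact, as \<open>rho\<close> and
  \<open>rho_U\<close> agree on \<open>X\<close>; below \<rho> the part in \<open>Y\<close> is
  not.\<close>

lemma clopen_sum_uniform_scattered:
  assumes t1: "t1_space W" and sum: "clopen_sum W X Y"
    and X: "strongly_uniform (subtopology W X)"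
    and Y: "scattered_of_type (subtopology W Y) (Type_pair \<rho> \<rho>)"
    and less: "rho_U (subtopology W X) < \<rho>" and le: "\<rho> \<le> nu (subtopology W X)"
  shows "CB_uniform W" "rho W = \<rho>"
proof -
  have op: "openin W X" "openin W Y" and XY: "X \<union> Y = topspace W"
    using sum by (auto simp: clopen_sum_def clopen_in_def)
  have split: "deriv_tail W \<xi> = (X \<inter> deriv_tail W \<xi>) \<union> (Y \<inter> deriv_tail W \<xi>)" for \<xi>
    using closedin_subset[OF closedin_deriv_tail[of W \<xi>]] XY by blast
  have Y_nu: "nu (subtopology W Y) = \<rho>" and Y_rho: "rho (subtopology W Y) = \<rho>"
    using Y by (auto simp: scattered_of_type_pair_iff)
  have X_uniform: "CB_uniform (subtopology W X)" and X_rho: "rho (subtopology W X) < \<rho>"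
    using X less by (auto simp: strongly_uniform_def)
  show "CB_uniform W"
    unfolding CB_uniform_iff[OF t1]
  proof (intro allI impI)
    fix \<xi> assume "deriv_tail W \<xi> \<noteq> {}"
    then consider "X \<inter> deriv_tail W \<xi> \<noteq> {}" | "Y \<inter> deriv_tail W \<xi> \<noteq> {}"
      using split by blast
    then have "X \<inter> deriv_tail W \<xi> \<noteq> {}"
    proof cases
      case 2
      then have "\<not> nu (subtopology W Y) \<le> \<xi>"
        using nu_subtopology_le_iff[OF op(2)] by blast
      then have "\<not> nu (subtopology W X) \<le> \<xi>"
        using le Y_nu by (metis order_trans)
      then show ?thesis
        using nu_subtopology_le_iff[OF op(1)] by blast
    qed
    then show "perfect_kernel W \<inter> deriv_tail W \<xi> \<noteq> {}"
      using X_uniform uniform_subtopology_iff[OF t1 op(1)] by blast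
  qed
  have "rho W \<le> \<xi> \<longleftrightarrow> \<rho> \<le> \<xi>" for \<xi>
  proof
    assume "rho W \<le> \<xi>"
    then have "compactin W (deriv_tail W \<xi>)"
      using rho_le_iff by blast
    then have "compactin W (Y \<inter> deriv_tail W \<xi>)"
      using sum by (intro closed_Int_compactin) (auto simp: clopen_sum_def clopen_in_def)
    then show "\<rho> \<le> \<xi>"
      using rho_subtopology_le_iff[OF op(2)] Y_rho by metis
  next
    assume "\<rho> \<le> \<xi>"
    then have "rho (subtopology W X) \<le> \<xi>" "rho (subtopology W Y) \<le> \<xi>"
      using X_rho Y_rho by auto
    then have "compactin W (X \<inter> deriv_tail W \<xi>)" "compactin W (Y \<inter> deriv_tail W \<xi>)"
      using rho_subtopology_le_iff op by blast+
    then have "compactin W (deriv_tail W \<xi>)"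
      by (subst split) (rule compactin_Un)
    then show "rho W \<le> \<xi>"
      using rho_le_iff by blast
  qed
  then show "rho W = \<rho>"
    by (meson order_antisym order_refl)
qed

lemma uniform_decomposition:
  assumes Stone: "omega_Stone_space W" and unif: "CB_uniform W" and less: "rho_U W < rho W"
  obtains X Y where "clopen_sum W X Y" "strongly_uniform (subtopology W X)"
    "scattered_of_type (subtopology W Y) (Type_pair (rho W) (rho W))"
    "rho_U (subtopology W X) < rho W" "rho W \<le> nu (subtopology W X)"
proof -
  define \<sigma> where "\<sigma> = rho_U W"
  let ?K = "perfect_kernel W" and ?T = "deriv_tail W"
  have W: "locally_compact_space W" "Hausdorff_space W" "totally_disconnected_space W"
    using Stone by (auto simp: omega_Stone_space_def)
  then have t1: "t1_space W" by (simp add: Hausdorff_imp_t1_space)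
  have clK: "closedin W ?K" using t1 by (rule closedin_perfect_kernel)
  have clT: "closedin W (?T \<xi>)" for \<xi> by (rule closedin_deriv_tail)
  have "compactin W (?K \<inter> ?T \<sigma>)" "compactin W (?T (rho W))"
    using rho_U_le_iff[OF t1, of \<sigma>] rho_le_iff[of W "rho W"] by (auto simp: \<sigma>_def)
  then have cpt: "compactin W (?K \<inter> ?T \<sigma> \<union> ?T (rho W))"
    by (rule compactin_Un)
  obtain A where A: "openin W A" "compactin W A" "?K \<inter> ?T \<sigma> \<union> ?T (rho W) \<subseteq> A"
    by (rule compact_open_between[OF W cpt openin_topspace compactin_subset_topspace[OF cpt]])
  have clA: "closedin W A" using A(2) W(2) by (simp add: compactin_imp_closedin)
  \<comment> \<open>Disjointness holds because \<open>A\<close> contains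
    \<open>?K \<inter> ?T \<sigma>\<close>.\<close>
  have "closedin W (?T \<sigma> - A)" "closedin W (A \<union> ?K)" "(?T \<sigma> - A) \<inter> (A \<union> ?K) = {}"
    using clT clK clA A by (auto simp: closedin_diff)
  from omega_Stone_clopen_separation[OF Stone this]
  obtain Y where Y: "clopen_in W Y" "?T \<sigma> - A \<subseteq> Y" "Y \<inter> (A \<union> ?K) = {}" .
  define X where "X = topspace W - Y"
  have op: "openin W X" "openin W Y"
    using Y(1) by (auto simp: X_def clopen_in_def)
  have cl: "closedin W X" "closedin W Y"
    using Y(1) by (auto simp: X_def clopen_in_def)
  have "Y \<subseteq> topspace W" using op(2) by (rule openin_subset)
  then have sum: "clopen_sum W X Y"
    using op cl by (auto simp: clopen_sum_def clopen_in_def X_def)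
  \<comment> \<open>The whole kernel lies in \<open>X\<close>, so \<open>rho_U\<close> and the
    uniformity condition carry over from \<open>W\<close> to \<open>X\<close>.\<close>
  have KX: "X \<inter> (?K \<inter> S) = ?K \<inter> S" for S
    using Y(3) perfect_kernel_subset_topspace[of W] unfolding X_def by blast
  have XT: "X \<inter> ?T \<sigma> \<subseteq> A"
    using Y(2) unfolding X_def by blast
  have "?T \<xi> \<subseteq> topspace W" for \<xi>
    by (rule closedin_subset[OF clT])
  then have split: "?T \<xi> = (X \<inter> ?T \<xi>) \<union> (Y \<inter> ?T \<xi>)" for \<xi>
    unfolding X_def by blast
  have X_rho_U: "rho_U (subtopology W X) \<le> \<xi> \<longleftrightarrow> \<sigma> \<le> \<xi>" for \<xi>
    unfolding \<sigma>_def rho_U_subtopology_le_iff[OF t1 op(1)] rho_U_le_iff[OF t1] KX ..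
  then have X_rho_U': "rho_U (subtopology W X) = \<sigma>"
    by (meson order_antisym order_refl)
  have "compactin W (X \<inter> ?T \<sigma>)"
    by (rule closed_compactin[OF A(2) XT]) (simp add: cl clT closedin_Int)
  then have "rho (subtopology W X) \<le> \<sigma>"
    using rho_subtopology_le_iff[OF op(1)] by blast
  moreover have "rho_U (subtopology W X) \<le> rho (subtopology W X)"
    using t1 by (intro rho_U_le_rho) (simp add: t1_space_subtopology)
  ultimately have X_rho: "rho (subtopology W X) = \<sigma>"
    using X_rho_U' by simp
  have KT: "?K \<inter> ?T \<xi> \<noteq> {}" if "?T \<xi> \<noteq> {}" for \<xi>
    using unif that unfolding CB_uniform_iff[OF t1] by blast
  have X_uniform: "CB_uniform (subtopology W X)"
    unfolding uniform_subtopology_iff[OF t1 op(1)] KX using KT by blast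
  \<comment> \<open>A tail missing \<open>X\<close> misses the kernel, so by uniformity it is empty
    and in particular compact.\<close>
  have X_nu: "rho W \<le> nu (subtopology W X)"
  proof -
    have "X \<inter> ?T (nu (subtopology W X)) = {}"
      using nu_subtopology_le_iff[OF op(1)] by blast
    then have "?T (nu (subtopology W X)) = {}"
      using KT KX by blast
    then have "compactin W (?T (nu (subtopology W X)))"
      by simp
    then show ?thesis
      using rho_le_iff by blast
  qed
  have "Y \<inter> ?T (rho W) = {}"
    using A(3) Y(3) by blast
  then have Y_nu: "nu (subtopology W Y) \<le> rho W"
    using nu_subtopology_le_iff[OF op(2)] by blast
  have Y_rho: "rho W \<le> rho (subtopology W Y)"
  proof -
    let ?\<xi> = "rho (subtopology W Y)"
    have cY: "compactin W (Y \<inter> ?T ?\<xi>)"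
      using rho_subtopology_le_iff[OF op(2)] by blast
    \<comment> \<open>From \<sigma> on the part of a tail in \<open>X\<close> is compact, so
      compactness in \<open>Y\<close> gives compactness of the whole tail. A smaller index is first
      raised to \<sigma>, which contradicts \<open>\<sigma> < rho W\<close>.\<close>
    show ?thesis
    proof (cases "\<sigma> \<le> ?\<xi>")
      case True
      then have "X \<inter> ?T ?\<xi> \<subseteq> A"
        using XT deriv_tail_antimono[OF True, of W] by blast
      then have "compactin W (X \<inter> ?T ?\<xi>)"
        by (rule closed_compactin[OF A(2)]) (simp add: cl clT closedin_Int)
      then have "compactin W (?T ?\<xi>)"
        by (subst split) (rule compactin_Un[OF _ cY])
      then show ?thesis
        using rho_le_iff by blast
    next
      case False
      have "compactin W (Y \<inter> ?T \<sigma>)"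
      proof (rule closed_compactin[OF cY])
        show "Y \<inter> ?T \<sigma> \<subseteq> Y \<inter> ?T ?\<xi>"
          using deriv_tail_antimono[of ?\<xi> \<sigma> W] False linear[of \<sigma> ?\<xi>] by blast
      qed (simp add: cl clT closedin_Int)
      moreover have "compactin W (X \<inter> ?T \<sigma>)" by fact
      ultimately have "compactin W (?T \<sigma>)"
        using compactin_Un split[of \<sigma>] by metis
      then have "rho W \<le> \<sigma>"
        using rho_le_iff by blast
      then show ?thesis
        using less by (simp add: \<sigma>_def)
    qed
  qed
  have "rho (subtopology W Y) \<le> nu (subtopology W Y)"
    by (rule rho_le_nu)
  then have "rho (subtopology W Y) = rho W" "nu (subtopology W Y) = rho W"
    using Y_nu Y_rho by auto
  moreover have "perfect_kernel (subtopology W Y) = {}"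
    using Y(3) perfect_kernel_subtopology_open[OF op(2)] by blast
  ultimately have "scattered_of_type (subtopology W Y) (Type_pair (rho W) (rho W))"
    by (simp add: scattered_of_type_pair_iff)
  then show thesis
    using that sum X_uniform X_rho X_rho_U' X_nu less
    by (simp add: strongly_uniform_def \<sigma>_def)
qed

text \<open>The value of \<rho> is a separate conjunct so that it concerns every admissible
  decomposition, not only the constructed one.\<close>

theorem theorem8:
  fixes W :: "'a topology"
  assumes "omega_Stone_space W"
  shows "(CB_uniform W \<longleftrightarrow>
            (\<exists>X Y. clopen_sum W X Y \<and> strongly_uniform (subtopology W X) \<and>
               (Y = {} \<or>
                (\<exists>\<rho>. scattered_of_type (subtopology W Y) (Type_pair \<rho> \<rho>) \<and>
                     rho_U (subtopology W X) < \<rho> \<and> \<rho> \<le> nu (subtopology W X)))))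
       \<and> (\<forall>X Y \<rho>. clopen_sum W X Y \<and> strongly_uniform (subtopology W X) \<and>
             scattered_of_type (subtopology W Y) (Type_pair \<rho> \<rho>) \<and>
             rho_U (subtopology W X) < \<rho> \<and> \<rho> \<le> nu (subtopology W X)
             \<longrightarrow> \<rho> = rho W)"
  (is "(_ \<longleftrightarrow> ?decomposable) \<and> _")
proof (intro conjI iffI allI impI)
  have t1: "t1_space W"
    using assms by (simp add: omega_Stone_space_def Hausdorff_imp_t1_space)
  show ?decomposable if unif: "CB_uniform W"
  \<comment> \<open>With equality \<open>W\<close> is itself strongly uniform, and \<open>Y\<close>
    is taken empty.\<close>
  proof (cases "rho_U W = rho W")
    case True
    have "clopen_sum W (topspace W) {}"
      by (simp add: clopen_sum_def clopen_in_def)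
    moreover have "strongly_uniform (subtopology W (topspace W))"
      using True unif by (simp add: strongly_uniform_def)
    ultimately show ?thesis by blast
  next
    case False
    then have "rho_U W < rho W"
      using rho_U_le_rho[OF t1] by simp
    from uniform_decomposition[OF assms unif this] show ?thesis by metis
  qed
  show "CB_uniform W" if dec: ?decomposable
  proof -
    obtain X Y where XY: "clopen_sum W X Y" "strongly_uniform (subtopology W X)"
      "Y = {} \<or> (\<exists>\<rho>. scattered_of_type (subtopology W Y) (Type_pair \<rho> \<rho>) \<and>
         rho_U (subtopology W X) < \<rho> \<and> \<rho> \<le> nu (subtopology W X))"
      using dec by blast
    show ?thesis
    proof (cases "Y = {}")
      case True
      then have "X = topspace W"
        using XY(1) by (simp add: clopen_sum_def)
      then show ?thesis
        using XY(2) by (simp add: strongly_uniform_def)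
    next
      case False
      then show ?thesis
        using clopen_sum_uniform_scattered(1)[OF t1 XY(1,2)] XY(3) by blast
    qed
  qed
  fix X Y \<rho>
  assume "clopen_sum W X Y \<and> strongly_uniform (subtopology W X) \<and>
      scattered_of_type (subtopology W Y) (Type_pair \<rho> \<rho>) \<and>
      rho_U (subtopology W X) < \<rho> \<and> \<rho> \<le> nu (subtopology W X)"
  then show "\<rho> = rho W"
    using clopen_sum_uniform_scattered(2)[OF t1, of X Y \<rho>] by simp
qed

end
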